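(* For every integer $N > 3$, \[ \theta(J(N,3)) = \begin{cases} 1, & N = 4,\\ 3, & N = 5,\\ \left\lfloor \frac{(N-1)^2}{4} \right\rfloor, & N > 5.\end{cases} \]
   Context: For integers $0<k<N$, let $[N]=\{1,\dots,N\}$ and let $\mathcal{P}_k([N])$ be the set of $k$-element subsets of $[N]$. The Johnson graph $J(N,k)$ has vertex set $\mathcal{P}_k([N])$, two vertices $S_1,S_2$ being adjacent iff $|S_1\cap S_2| = k-1$. A (vertex) clique cover of a graph $G$ is a collection of cliques of $G$ whose vertex sets together contain every vertex of $G$; $\theta(G)$ denotes the smallest cardinality of a clique cover of $G$. *)

theory Defs
  imports "HOL-Library.Ramsey"
begin

text \<open>
  A simple graph is a pair \<open>(V, E)\<close> of a vertex set and a set \<open>E \<subseteq> [V]\<^bsup>2\<^esup>\<close> of unordered pairs,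
  the representation of edges used by \<^const>\<open>clique\<close>.
\<close>

type_synonym 'a graph = "'a set \<times> 'a set set"

definition simple_graph :: "'a graph \<Rightarrow> bool" where
  "simple_graph G \<longleftrightarrow> snd G \<subseteq> [fst G]\<^bsup>2\<^esup>"

definition johnson_graph :: "nat \<Rightarrow> nat \<Rightarrow> nat set graph" where
  "johnson_graph N k =
     ([{1..N}]\<^bsup>k\<^esup>,
      {{S, T} |S T. S \<in> [{1..N}]\<^bsup>k\<^esup> \<and> T \<in> [{1..N}]\<^bsup>k\<^esup> \<and> card (S \<inter> T) = k - 1})"

text \<open>
  For \<open>k = 0\<close> truncated subtraction would produce a loop at the empty set; for \<open>k > 0\<close> adjacent
  vertices are automatically distinct.
\<close>

lemma simple_graph_johnson_graph:
  assumes "0 < k"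
  shows "simple_graph (johnson_graph N k)"
proof -
  have "S \<noteq> T" if "card S = k" "card (S \<inter> T) = k - 1" for S T :: "nat set"
    using that assms by auto
  then show ?thesis
    by (auto simp: simple_graph_def johnson_graph_def nsets_def card_insert_if)
qed

text \<open>
  A clique is identified with its vertex set. The empty set counts as a clique, which has no
  effect on the smallest size of a cover. Members of a cover may overlap.
\<close>

definition clique_cover :: "'a graph \<Rightarrow> 'a set set \<Rightarrow> bool" where
  "clique_cover G \<C> \<longleftrightarrow>
     (\<forall>C\<in>\<C>. C \<subseteq> fst G \<and> clique C (snd G)) \<and> \<Union>\<C> = fst G"

text \<open>
  Only finite covers are counted, since \<^const>\<open>card\<close> of an infinite set is \<open>0\<close>. The number is
  meaningful whenever a finite cover exists, in particular for every finite graph.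
\<close>

definition clique_cover_number :: "'a graph \<Rightarrow> nat" (\<open>\<theta>\<close>) where
  "clique_cover_number G = (LEAST m. \<exists>\<C>. finite \<C> \<and> clique_cover G \<C> \<and> card \<C> = m)"

lemma ex_finite_clique_cover:
  assumes "finite (fst G)"
  shows "\<exists>\<C>. finite \<C> \<and> clique_cover G \<C>"
  by (rule exI[of _ "(\<lambda>v. {v}) ` fst G"])
    (use assms in \<open>auto simp: clique_cover_def clique_def\<close>)

end

theory Submission
  imports Defs
begin

text \<open>
  A clique of \<open>J(N,3)\<close> consists of triples through a common pair or of triples inside a common
  4-set. So a clique cover amounts to a set \<open>P\<close> of \<open>p\<close> pairs and a set \<open>Q\<close> of \<open>q\<close> 4-sets such that
  each triple contains a member of \<open>P\<close> or lies in a member of \<open>Q\<close>. The optimum for \<open>N \<ge> 6\<close> takes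
  for \<open>P\<close> all pairs inside either half of the ground set and no 4-sets.

  For the lower bound, Goodman's count of the triples containing no pair of \<open>P\<close> gives
  \<open>3 C(N,3) + 2 \<Sum>\<^sub>v C(d(v),2) \<le> 3 p (N - 2) + 12 q\<close>, where \<open>d\<close> is the degree in the graph \<open>P\<close>. By
  convexity of \<open>C(d,2)\<close> this settles \<open>N = 5\<close> and \<open>N \<ge> 8\<close>. For \<open>N = 6\<close> and \<open>N = 7\<close> it is combined with
  the count of the triples that avoid a fixed vertex; rounding makes this second count strong
  enough, apart from the case \<open>p = 1\<close>, \<open>q = 4\<close> for \<open>N = 6\<close>, where every pair outside \<open>P\<close> would lie in
  at least two of the 4-sets.
\<close>

section \<open>Counting\<close>

lemma card_supersets:
  assumes "finite U" "E \<subseteq> U" "card E \<le> k"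
  shows "card {T \<in> [U]\<^bsup>k\<^esup>. E \<subseteq> T} = (card U - card E) choose (k - card E)"
proof -
  have fE: "finite E" using assms finite_subset by blast
  have "bij_betw (\<lambda>T. T \<union> E) (nsets (U - E) (k - card E)) {T \<in> [U]\<^bsup>k\<^esup>. E \<subseteq> T}"
  proof (rule bij_betw_byWitness[where f' = "\<lambda>T. T - E"])
    show "(\<lambda>T. T \<union> E) ` nsets (U - E) (k - card E) \<subseteq> {T \<in> [U]\<^bsup>k\<^esup>. E \<subseteq> T}"
    proof clarify
      fix T assume T: "T \<in> nsets (U - E) (k - card E)"
      then have "card (T \<union> E) = card T + card E"
        using fE by (intro card_Un_disjoint) (auto simp: nsets_def)
      with T show "T \<union> E \<in> [U]\<^bsup>k\<^esup> \<and> E \<subseteq> T \<union> E"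
        using assms fE by (auto simp: nsets_def)
    qed
    show "(\<lambda>T. T - E) ` {T \<in> [U]\<^bsup>k\<^esup>. E \<subseteq> T} \<subseteq> nsets (U - E) (k - card E)"
      using fE by (auto simp: nsets_def card_Diff_subset)
  qed (auto simp: nsets_def)
  then have "card {T \<in> [U]\<^bsup>k\<^esup>. E \<subseteq> T} = card (nsets (U - E) (k - card E))"
    by (rule bij_betw_same_card[symmetric])
  then show ?thesis
    using assms fE by (simp add: card_Diff_subset)
qed

lemma sum_card_incidence:
  assumes "finite A" "finite B"
  shows "(\<Sum>a\<in>A. card {b \<in> B. R a b}) = (\<Sum>b\<in>B. card {a \<in> A. R a b})"
  using sum_multicount_gen[OF assms(2,1), of "\<lambda>b a. R a b" "\<lambda>a. card {b \<in> B. R a b}"]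
  by simp

lemma two_choose_two: "2 * (n choose 2) = n * (n - 1)" for n :: nat
  by (cases n) (simp_all add: choose_two)

text \<open>The right side exceeds the left by \<open>(d - k) * (d - k - 1)\<close>, a product of
  consecutive integers. So this is the chord of the convex function C(d,2) through
  \<open>d = k\<close> and \<open>d = k + 1\<close>, which bounds it from below at every natural
  number.\<close>

lemma choose_two_tangent: "2 * k * d \<le> 2 * (d choose 2) + k * (k + 1)" for d k :: nat
proof -
  have "2 * (d choose 2) = d * (d - 1)" by (rule two_choose_two)
  then have c: "int (2 * (d choose 2)) = int d * (int d - 1)"
    by (cases d) (simp_all add: algebra_simps)
  have "0 \<le> (int d - int k) * (int d - int k - 1)"
    by (cases "d \<le> k") (simp_all add: mult_nonpos_nonpos)
  then have "int (2 * k * d) \<le> int (2 * (d choose 2)) + int (k * (k + 1))"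
    unfolding c by (simp add: algebra_simps)
  then show ?thesis by linarith
qed

text \<open>The argument \<open>m + 2\<close> keeps truncated subtraction out of the three
  factors.\<close>

lemma six_choose_three: "6 * ((m + 2) choose 3) = (m + 2) * (m + 1) * m"
proof (induction m)
  case (Suc m)
  have "(Suc m + 2) choose 3 = ((m + 2) choose 2) + ((m + 2) choose 3)"
    by (simp add: eval_nat_numeral)
  moreover have "2 * ((m + 2) choose 2) = (m + 2) * (m + 1)"
    using two_choose_two[of "m + 2"] by simp
  ultimately have "6 * ((Suc m + 2) choose 3) = 3 * ((m + 2) * (m + 1)) + (m + 2) * (m + 1) * m"
    using Suc by simp
  then show ?case by (simp add: algebra_simps)
qed (simp add: eval_nat_numeral)

section \<open>Covers by pairs and 4-sets\<close>

locale pair_quad_cover =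
  fixes U :: "'a set" and P Q :: "'a set set"
  assumes finite_U: "finite U"
    and P: "P \<subseteq> [U]\<^bsup>2\<^esup>" and Q: "Q \<subseteq> [U]\<^bsup>4\<^esup>"
    and covers: "T \<in> [U]\<^bsup>3\<^esup> \<Longrightarrow> (\<exists>e\<in>P. e \<subseteq> T) \<or> (\<exists>A\<in>Q. T \<subseteq> A)"
begin

definition pdeg :: "'a \<Rightarrow> nat" where "pdeg v = card {e \<in> P. v \<in> e}"

definition qdeg :: "'a \<Rightarrow> nat" where "qdeg v = card {A \<in> Q. v \<in> A}"

lemma finite_P: "finite P" and finite_Q: "finite Q"
  using P Q finite_U finite_imp_finite_nsets finite_subset by blast+

lemma P_D: "e \<in> P \<Longrightarrow> e \<subseteq> U \<and> finite e \<and> card e = 2"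
  and Q_D: "A \<in> Q \<Longrightarrow> A \<subseteq> U \<and> finite A \<and> card A = 4"
  using P Q by (auto simp: nsets_def)

lemma sum_pdeg: "(\<Sum>v\<in>U. pdeg v) = 2 * card P"
proof -
  have "(\<Sum>v\<in>U. pdeg v) = (\<Sum>e\<in>P. card {v \<in> U. v \<in> e})"
    unfolding pdeg_def by (rule sum_card_incidence[OF finite_U finite_P])
  also have "\<dots> = (\<Sum>e\<in>P. 2)"
    by (rule sum.cong) (use P_D in \<open>auto simp: Int_absorb1 simp flip: Int_def\<close>)
  finally show ?thesis by simp
qed

lemma sum_qdeg: "(\<Sum>v\<in>U. qdeg v) = 4 * card Q"
proof -
  have "(\<Sum>v\<in>U. qdeg v) = (\<Sum>A\<in>Q. card {v \<in> U. v \<in> A})"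
    unfolding qdeg_def by (rule sum_card_incidence[OF finite_U finite_Q])
  also have "\<dots> = (\<Sum>A\<in>Q. 4)"
    by (rule sum.cong) (use Q_D in \<open>auto simp: Int_absorb1 simp flip: Int_def\<close>)
  finally show ?thesis by simp
qed

section \<open>Goodman's count of triples\<close>

lemma cherries_at:
  assumes v: "v \<in> U"
  shows "card {T \<in> [U]\<^bsup>3\<^esup>. v \<in> T \<and> (\<forall>w\<in>T - {v}. {v, w} \<in> P)} = pdeg v choose 2"
proof -
  \<comment> \<open>\<open>W\<close> is the neighbourhood of \<open>v\<close> in the graph
    \<open>P\<close>. Its elements match the pairs through \<open>v\<close>, and each counted triple
    is \<open>v\<close> together with two of them.\<close>
  define W where "W = {w. w \<noteq> v \<and> {v, w} \<in> P}"
  have WU: "W \<subseteq> U" using P_D unfolding W_def by blast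
  then have fW: "finite W" using finite_U finite_subset by blast
  have "bij_betw (\<lambda>w. {v, w}) W {e \<in> P. v \<in> e}"
  proof (rule bij_betw_imageI)
    show "inj_on (\<lambda>w. {v, w}) W" by (auto simp: inj_on_def W_def doubleton_eq_iff)
    show "(\<lambda>w. {v, w}) ` W = {e \<in> P. v \<in> e}"
    proof (rule set_eqI, rule iffI)
      fix e assume "e \<in> {e \<in> P. v \<in> e}"
      then have e: "e \<in> P" "v \<in> e" by auto
      then obtain x y where "e = {x, y}" "x \<noteq> y" using P_D[OF e(1)] by (auto simp: card_2_iff)
      then obtain w where "e = {v, w}" "w \<noteq> v" using e by auto
      then show "e \<in> (\<lambda>w. {v, w}) ` W" using e by (auto simp: W_def)
    qed (auto simp: W_def)
  qed
  then have cW: "card W = pdeg v" unfolding pdeg_def by (rule bij_betw_same_card)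
  have "bij_betw (insert v) ([W]\<^bsup>2\<^esup>) {T \<in> [U]\<^bsup>3\<^esup>. v \<in> T \<and> (\<forall>w\<in>T - {v}. {v, w} \<in> P)}"
  proof (rule bij_betw_byWitness[where f' = "\<lambda>T. T - {v}"])
    show "insert v ` [W]\<^bsup>2\<^esup> \<subseteq> {T \<in> [U]\<^bsup>3\<^esup>. v \<in> T \<and> (\<forall>w\<in>T - {v}. {v, w} \<in> P)}"
    proof clarify
      fix S assume S: "S \<in> [W]\<^bsup>2\<^esup>"
      then have "v \<notin> S" by (auto simp: nsets_def W_def)
      with S show "insert v S \<in> [U]\<^bsup>3\<^esup> \<and> v \<in> insert v S \<and> (\<forall>w\<in>insert v S - {v}. {v, w} \<in> P)"
        using v WU by (auto simp: nsets_def W_def)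
    qed
  qed (auto simp: nsets_def W_def)
  then have "card {T \<in> [U]\<^bsup>3\<^esup>. v \<in> T \<and> (\<forall>w\<in>T - {v}. {v, w} \<in> P)} = card ([W]\<^bsup>2\<^esup>)"
    by (rule bij_betw_same_card[symmetric])
  then show ?thesis by (simp add: cW)
qed

text \<open>If \<open>T\<close> contains 0, 1, 2 or 3 pairs of \<open>P\<close>, then 0, 0, 1 or 3
  of its vertices are joined in \<open>P\<close> to both others, so the left side is 3, 3, 5 or 9.
  The pairs alone contribute 0, 3, 6 or 9 on the right; only in the first case does a 4-set have to
  help.\<close>

lemma triple_weight:
  assumes T: "T \<in> [U]\<^bsup>3\<^esup>"
  shows "3 + 2 * card {v \<in> U. v \<in> T \<and> (\<forall>w\<in>T - {v}. {v, w} \<in> P)}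
    \<le> 3 * card {e \<in> P. e \<subseteq> T} + 3 * card {A \<in> Q. T \<subseteq> A}"
proof -
  obtain x y z where T_eq: "T = {x, y, z}" and ne: "x \<noteq> y" "x \<noteq> z" "y \<noteq> z"
    using T by (auto simp: nsets_def card_3_iff)
  have TU: "x \<in> U" "y \<in> U" "z \<in> U" using T T_eq by (auto simp: nsets_def)
  have sub: "e \<in> P \<and> e \<subseteq> T \<longleftrightarrow> e \<in> P \<and> (e = {x, y} \<or> e = {x, z} \<or> e = {y, z})" for e
  proof -
    have "e = {x, y} \<or> e = {x, z} \<or> e = {y, z}" if e: "e \<in> P" "e \<subseteq> T"
    proof -
      obtain a b where "e = {a, b}" "a \<noteq> b" using P_D[OF e(1)] by (auto simp: card_2_iff)
      moreover from this e have "a \<in> {x, y, z}" "b \<in> {x, y, z}" by (simp_all add: T_eq)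
      ultimately show ?thesis by (elim insertE emptyE) (simp_all add: insert_commute)
    qed
    then show ?thesis by (auto simp: T_eq)
  qed
  have c: "{e \<in> P. e \<subseteq> T} = (if {x, y} \<in> P then {{x, y}} else {}) \<union>
      (if {x, z} \<in> P then {{x, z}} else {}) \<union> (if {y, z} \<in> P then {{y, z}} else {})"
    unfolding sub by auto
  have Tx: "T - {x} = {y, z}" and Ty: "T - {y} = {x, z}" and Tz: "T - {z} = {x, y}"
    using ne by (auto simp: T_eq)
  have comm: "{y, x} = {x, y}" "{z, x} = {x, z}" "{z, y} = {y, z}" by auto
  have "{v \<in> U. v \<in> T \<and> (\<forall>w\<in>T - {v}. {v, w} \<in> P)} =
      {v \<in> {x}. \<forall>w\<in>T - {x}. {x, w} \<in> P} \<union> {v \<in> {y}. \<forall>w\<in>T - {y}. {y, w} \<in> P}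
        \<union> {v \<in> {z}. \<forall>w\<in>T - {z}. {z, w} \<in> P}"
    using TU unfolding T_eq by blast
  then have i: "{v \<in> U. v \<in> T \<and> (\<forall>w\<in>T - {v}. {v, w} \<in> P)} =
      (if {x, y} \<in> P \<and> {x, z} \<in> P then {x} else {}) \<union>
      (if {x, y} \<in> P \<and> {y, z} \<in> P then {y} else {}) \<union>
      (if {x, z} \<in> P \<and> {y, z} \<in> P then {z} else {})"
    unfolding Tx Ty Tz by (simp add: comm)
  \<comment> \<open>The covering hypothesis enters here: a triple without a pair of \<open>P\<close>
    lies in some 4-set of \<open>Q\<close>.\<close>
  have r: "card {A \<in> Q. T \<subseteq> A} \<ge> 1" if "{e \<in> P. e \<subseteq> T} = {}"
  proof -
    have "{A \<in> Q. T \<subseteq> A} \<noteq> {}" using covers[OF T] that by blast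
    then show ?thesis
      using finite_Q by (simp add: Suc_le_eq card_gt_0_iff)
  qed
  have ne2: "{x, y} \<noteq> {x, z}" "{x, y} \<noteq> {y, z}" "{x, z} \<noteq> {y, z}"
    using ne by (simp_all add: doubleton_eq_iff)
  show ?thesis
    using r ne ne2 unfolding c i
    by (cases "{x, y} \<in> P"; cases "{x, z} \<in> P"; cases "{y, z} \<in> P") simp_all
qed

text \<open>Sum \<open>triple_weight\<close> over all triples and exchange the order of summation. A
  pair lies in \<open>card U - 2\<close> triples and a 4-set contains 4, whence the factor
  \<open>12 = 3 * 4\<close>.\<close>

lemma goodman:
  "3 * (card U choose 3) + 2 * (\<Sum>v\<in>U. pdeg v choose 2)
    \<le> 3 * (card P * (card U - 2)) + 12 * card Q"
proof -
  have fT: "finite ([U]\<^bsup>3\<^esup>)" by (simp add: finite_U finite_imp_finite_nsets)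
  have "(\<Sum>v\<in>U. pdeg v choose 2)
     = (\<Sum>v\<in>U. card {T \<in> [U]\<^bsup>3\<^esup>. v \<in> T \<and> (\<forall>w\<in>T - {v}. {v, w} \<in> P)})"
    by (simp only: cherries_at cong: sum.cong)
  also have "\<dots> = (\<Sum>T\<in>[U]\<^bsup>3\<^esup>. card {v \<in> U. v \<in> T \<and> (\<forall>w\<in>T - {v}. {v, w} \<in> P)})"
    by (rule sum_card_incidence[OF finite_U fT])
  finally have "3 * (card U choose 3) + 2 * (\<Sum>v\<in>U. pdeg v choose 2)
     = (\<Sum>T\<in>[U]\<^bsup>3\<^esup>. 3 + 2 * card {v \<in> U. v \<in> T \<and> (\<forall>w\<in>T - {v}. {v, w} \<in> P)})"
    by (simp add: sum.distrib flip: sum_distrib_left)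
  also have "\<dots> \<le> (\<Sum>T\<in>[U]\<^bsup>3\<^esup>. 3 * card {e \<in> P. e \<subseteq> T} + 3 * card {A \<in> Q. T \<subseteq> A})"
    by (rule sum_mono[OF triple_weight])
  also have "\<dots> = 3 * (\<Sum>T\<in>[U]\<^bsup>3\<^esup>. card {e \<in> P. e \<subseteq> T})
      + 3 * (\<Sum>T\<in>[U]\<^bsup>3\<^esup>. card {A \<in> Q. T \<subseteq> A})"
    by (simp add: sum.distrib flip: sum_distrib_left)
  also have "(\<Sum>T\<in>[U]\<^bsup>3\<^esup>. card {e \<in> P. e \<subseteq> T}) = (\<Sum>e\<in>P. card {T \<in> [U]\<^bsup>3\<^esup>. e \<subseteq> T})"
    by (rule sum_card_incidence[OF fT finite_P])
  also have "(\<Sum>T\<in>[U]\<^bsup>3\<^esup>. card {A \<in> Q. T \<subseteq> A}) = (\<Sum>A\<in>Q. card {T \<in> [U]\<^bsup>3\<^esup>. T \<subseteq> A})"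
    by (rule sum_card_incidence[OF fT finite_Q])
  also have "(\<Sum>e\<in>P. card {T \<in> [U]\<^bsup>3\<^esup>. e \<subseteq> T}) = (\<Sum>e\<in>P. card U - 2)"
    by (rule sum.cong) (use P_D in \<open>simp_all add: card_supersets finite_U\<close>)
  also have "(\<Sum>A\<in>Q. card {T \<in> [U]\<^bsup>3\<^esup>. T \<subseteq> A}) = (\<Sum>A\<in>Q. 4)"
  proof (rule sum.cong[OF refl])
    fix A assume A: "A \<in> Q"
    have "{T \<in> [U]\<^bsup>3\<^esup>. T \<subseteq> A} = [A]\<^bsup>3\<^esup>" using Q_D[OF A] by (auto simp: nsets_def)
    then show "card {T \<in> [U]\<^bsup>3\<^esup>. T \<subseteq> A} = 4"
      using Q_D[OF A] by (simp add: eval_nat_numeral)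
  qed
  finally show ?thesis by simp
qed

lemma two_sum_choose_pdeg_ge:
  "4 * k * card P \<le> 2 * (\<Sum>v\<in>U. pdeg v choose 2) + card U * (k * (k + 1))"
proof -
  have "(\<Sum>v\<in>U. 2 * k * pdeg v) \<le> (\<Sum>v\<in>U. 2 * (pdeg v choose 2) + k * (k + 1))"
    by (rule sum_mono[OF choose_two_tangent])
  moreover have "(\<Sum>v\<in>U. 2 * k * pdeg v) = 2 * k * (2 * card P)"
    by (simp only: sum_pdeg flip: sum_distrib_left)
  moreover have "(\<Sum>v\<in>U. 2 * (pdeg v choose 2) + k * (k + 1))
      = 2 * (\<Sum>v\<in>U. pdeg v choose 2) + card U * (k * (k + 1))"
    by (simp add: sum.distrib flip: sum_distrib_left)
  ultimately show ?thesis by simp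
qed

text \<open>Convexity replaces the degree sum by a term linear in \<open>card P\<close>. The
  parameter \<open>k\<close> is free; the bound is strongest for \<open>k\<close> near the average
  degree of the graph \<open>P\<close>.\<close>

lemma goodman_linear:
  "3 * (card U choose 3) + 4 * k * card P
    \<le> 3 * (card P * (card U - 2)) + 12 * card Q + card U * (k * (k + 1))"
  using goodman two_sum_choose_pdeg_ge[of k] by linarith

text \<open>Count the triples that avoid \<open>v\<close>. A pair lies in \<open>card U - 3\<close>
  of them, or in none if it contains \<open>v\<close>; a 4-set contains 4 of them, or only 1 if it
  contains \<open>v\<close>. The terms with \<open>pdeg v\<close> and \<open>qdeg v\<close> are
  these losses, moved to the left to avoid subtraction.\<close>

lemma delete_vertex:
  assumes v: "v \<in> U" and U: "card U \<ge> 3"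
  shows "((card U - 1) choose 3) + (card U - 3) * pdeg v + 3 * qdeg v
    \<le> (card U - 3) * card P + 4 * card Q"
proof -
  let ?X = "[U - {v}]\<^bsup>3\<^esup>"
  have fX: "finite ?X" by (simp add: finite_U finite_imp_finite_nsets)
  have ge1: "1 \<le> card {e \<in> P. e \<subseteq> T} + card {A \<in> Q. T \<subseteq> A}" if T: "T \<in> ?X" for T
  proof -
    have "T \<in> [U]\<^bsup>3\<^esup>" using T by (auto simp: nsets_def)
    then have "{e \<in> P. e \<subseteq> T} \<noteq> {} \<or> {A \<in> Q. T \<subseteq> A} \<noteq> {}" using covers by blast
    then show ?thesis using finite_P finite_Q by (auto simp: Suc_le_eq card_gt_0_iff)
  qed
  have p: "card {T \<in> ?X. e \<subseteq> T} + (if v \<in> e then card U - 3 else 0) = card U - 3"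
    if e: "e \<in> P" for e
  proof (cases "v \<in> e")
    case True
    then have "{T \<in> ?X. e \<subseteq> T} = {}" by (auto simp: nsets_def)
    with True show ?thesis by (simp only: card.empty) simp
  next
    case False
    then have "card {T \<in> ?X. e \<subseteq> T} = (card (U - {v}) - card e) choose (3 - card e)"
      using P_D[OF e] finite_U by (intro card_supersets) auto
    with False show ?thesis using P_D[OF e] v finite_U by simp
  qed
  have q: "card {T \<in> ?X. T \<subseteq> A} + (if v \<in> A then 3 else 0) = 4" if A: "A \<in> Q" for A
  proof -
    have "{T \<in> ?X. T \<subseteq> A} = [A - {v}]\<^bsup>3\<^esup>" using Q_D[OF A] by (auto simp: nsets_def)
    then show ?thesis
      using Q_D[OF A] by (simp add: card_Diff_singleton_if eval_nat_numeral)
  qed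
  have "(card U - 1) choose 3 = (\<Sum>T\<in>?X. 1)"
    using v finite_U by simp
  also have "\<dots> \<le> (\<Sum>T\<in>?X. card {e \<in> P. e \<subseteq> T} + card {A \<in> Q. T \<subseteq> A})"
    by (rule sum_mono[OF ge1])
  also have "\<dots> = (\<Sum>T\<in>?X. card {e \<in> P. e \<subseteq> T}) + (\<Sum>T\<in>?X. card {A \<in> Q. T \<subseteq> A})"
    by (rule sum.distrib)
  also have "(\<Sum>T\<in>?X. card {e \<in> P. e \<subseteq> T}) = (\<Sum>e\<in>P. card {T \<in> ?X. e \<subseteq> T})"
    by (rule sum_card_incidence[OF fX finite_P])
  also have "(\<Sum>T\<in>?X. card {A \<in> Q. T \<subseteq> A}) = (\<Sum>A\<in>Q. card {T \<in> ?X. T \<subseteq> A})"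
    by (rule sum_card_incidence[OF fX finite_Q])
  finally have "(card U - 1) choose 3
    \<le> (\<Sum>e\<in>P. card {T \<in> ?X. e \<subseteq> T}) + (\<Sum>A\<in>Q. card {T \<in> ?X. T \<subseteq> A})" .
  moreover have "(\<Sum>e\<in>P. card {T \<in> ?X. e \<subseteq> T}) + (card U - 3) * pdeg v = (card U - 3) * card P"
  proof -
    have "(\<Sum>e\<in>P. if v \<in> e then card U - 3 else 0) = (card U - 3) * pdeg v"
      using finite_P by (simp add: pdeg_def sum.If_cases Int_def)
    then show ?thesis
      using sum.cong[OF refl p, of P "\<lambda>e. e"] by (simp add: sum.distrib)
  qed
  moreover have "(\<Sum>A\<in>Q. card {T \<in> ?X. T \<subseteq> A}) + 3 * qdeg v = 4 * card Q"
  proof -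
    have "(\<Sum>A\<in>Q. if v \<in> A then 3 else 0) = 3 * qdeg v"
      using finite_Q by (simp add: qdeg_def sum.If_cases Int_def)
    then show ?thesis
      using sum.cong[OF refl q, of Q "\<lambda>A. A"] by (simp add: sum.distrib)
  qed
  ultimately show ?thesis by linarith
qed

section \<open>Lower bounds by size of the ground set\<close>

lemma lower_bound_seven:
  assumes U: "card U = 7"
  shows "9 \<le> card P + card Q"
proof (rule ccontr)
  assume "\<not> ?thesis"
  then have pq: "card P + card Q \<le> 8" by simp
  have U3: "3 \<le> card U" using U by simp
  \<comment> \<open>Deleting \<open>v\<close> leaves
    \<open>4 * pdeg v + 3 * qdeg v \<le> 4 * 8 - 20\<close>. By rounding, \<open>qdeg v\<close> is
    at most 4, 2, 1 or 0 when \<open>pdeg v\<close> is 0, 1, 2 or 3, and the inequality fits these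
    four cases.\<close>
  have "qdeg v + 2 * pdeg v \<le> 4 + (pdeg v choose 2)" if v: "v \<in> U" for v
  proof -
    have c: "(6 :: nat) choose 3 = 20" by (simp add: eval_nat_numeral)
    have "4 * pdeg v + 3 * qdeg v \<le> 12"
      using delete_vertex[OF v U3] pq c by (simp add: U)
    moreover from this have "pdeg v \<in> {0, 1, 2, 3}" by auto
    ultimately show ?thesis by (auto simp: eval_nat_numeral)
  qed
  then have "(\<Sum>v\<in>U. qdeg v + 2 * pdeg v) \<le> (\<Sum>v\<in>U. 4 + (pdeg v choose 2))"
    by (rule sum_mono)
  then have "4 * card Q + 4 * card P \<le> 28 + (\<Sum>v\<in>U. pdeg v choose 2)"
    by (simp add: sum.distrib sum_pdeg sum_qdeg U flip: sum_distrib_left)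
  moreover have "(7 :: nat) choose 3 = 35" by (simp add: eval_nat_numeral)
  \<comment> \<open>Let S be the sum of \<open>pdeg v choose 2\<close>. Goodman's bound and the
    tangent with \<open>k = 1\<close> force \<open>card P + card Q = 8\<close> and
    \<open>card P \<le> 5\<close>, hence S \<le> 3. The sum of the local inequalities gives S \<ge>
    4.\<close>
  ultimately show False
    using goodman two_sum_choose_pdeg_ge[of 1] pq by (simp add: U)
qed

lemma lower_bound_medium:
  assumes U: "8 \<le> card U" "card U \<le> 12"
  shows "(card U - 1)\<^sup>2 div 4 \<le> card P + card Q"
proof (rule ccontr)
  assume less: "\<not> ?thesis"
  have c: "(8 :: nat) choose 3 = 56" "(9 :: nat) choose 3 = 84" "(10 :: nat) choose 3 = 120"
    "(11 :: nat) choose 3 = 165" "(12 :: nat) choose 3 = 220" by (simp_all add: eval_nat_numeral)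
  \<comment> \<open>Sizes 9, 10, 11 and 12 are settled by \<open>k\<close> = 2, 3, 3 and 4. Size 8
    needs two values: if \<open>card P + card Q \<le> 11\<close>, then \<open>k = 1\<close> forces
    \<open>card P \<ge> 10\<close> while \<open>k = 2\<close> forces
    \<open>card P \<le> 6\<close>.\<close>
  note g = goodman_linear[of 0] goodman_linear[of 1] goodman_linear[of 2] goodman_linear[of 3]
    goodman_linear[of 4] goodman_linear[of 5]
  consider "card U = 8" | "card U = 9" | "card U = 10" | "card U = 11" | "card U = 12"
    using U by linarith
  then show False by cases (use less g in \<open>simp_all add: c\<close>)
qed

text \<open>
  In the extremal configuration all degrees are \<open>j\<close> or \<open>j + 1\<close>, where \<open>N = 2 j + 2\<close> or \<open>N = 2 j + 3\<close>;
  there the linear bound with parameter \<open>j\<close> is tight. The coefficient of \<open>p\<close> in it is then \<open>2 j\<close> or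
  \<open>2 j + 3\<close>, which is at least the coefficient \<open>12\<close> of \<open>q\<close> as soon as \<open>N \<ge> 13\<close>.
\<close>

lemma lower_bound_large:
  assumes U: "13 \<le> card U"
  shows "(card U - 1)\<^sup>2 div 4 \<le> card P + card Q"
proof (cases "even (card U)")
  case True
  then obtain m where m: "card U = 2 * m" by blast
  obtain j where j: "m = j + 1" "6 \<le> j" using U m by (intro that[of "m - 1"]) simp_all
  have n: "card U = 2 * j + 2" using m j by simp
  have c: "3 * ((2 * j + 2) choose 3) = (2 * j + 2) * (2 * j + 1) * j"
    using six_choose_three[of "2 * j"] by simp
  have "(2 * j) * (j * (j + 1)) \<le> (2 * j) * card P + 12 * card Q"
    using goodman_linear[of j] unfolding n c by (simp add: algebra_simps)
  also have "\<dots> \<le> (2 * j) * (card P + card Q)"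
    using j by (simp add: distrib_left)
  finally have "j * (j + 1) \<le> card P + card Q" using j by simp
  moreover have "(card U - 1)\<^sup>2 = 4 * (j * (j + 1)) + 1"
    by (simp add: n power2_eq_square algebra_simps)
  ultimately show ?thesis by simp
next
  case False
  then obtain m where m: "card U = 2 * m + 1" using oddE by blast
  obtain j where j: "m = j + 1" "5 \<le> j" using U m by (intro that[of "m - 1"]) simp_all
  have n: "card U = 2 * j + 3" using m j by simp
  have c: "3 * ((2 * j + 3) choose 3) = (2 * j + 3) * (j + 1) * (2 * j + 1)"
    using six_choose_three[of "2 * j + 1"] by (simp add: eval_nat_numeral algebra_simps)
  have "(2 * j + 3) * (j + 1)\<^sup>2 \<le> (2 * j + 3) * card P + 12 * card Q"
    using goodman_linear[of j] unfolding n c by (simp add: algebra_simps power2_eq_square)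
  also have "\<dots> \<le> (2 * j + 3) * (card P + card Q)"
    using j by (simp add: distrib_left)
  finally have "(j + 1)\<^sup>2 \<le> card P + card Q" by (simp only: mult_le_cancel1)
  moreover have "(card U - 1)\<^sup>2 = 4 * (j + 1)\<^sup>2"
    by (simp add: n power2_eq_square algebra_simps)
  ultimately show ?thesis by simp
qed

text \<open>Goodman's bound gives \<open>30 \<le> 9 * card P + 12 * card Q\<close>, so fewer than 3
  sets are impossible.\<close>

lemma lower_bound_five:
  assumes U: "card U = 5"
  shows "3 \<le> card P + card Q"
proof -
  have "(5 :: nat) choose 3 = 10" by (simp add: eval_nat_numeral)
  then show ?thesis using goodman by (simp add: U)
qed

text \<open>Four triples contain \<open>f\<close>, and at most one of them,
  \<open>e \<union> f\<close>, also contains \<open>e\<close>. The other three or four must lie in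
  4-sets over \<open>f\<close>, each of which contains only two triples through
  \<open>f\<close>.\<close>

lemma quads_over_pair:
  assumes U: "card U = 6" and Pe: "P = {e}" and f: "f \<in> [U]\<^bsup>2\<^esup>" "f \<noteq> e"
  shows "2 \<le> card {A \<in> Q. f \<subseteq> A}"
proof -
  let ?F = "{A \<in> Q. f \<subseteq> A}"
  have f2: "f \<subseteq> U" "finite f" "card f = 2" using f by (auto simp: nsets_def)
  have e2: "finite e" "card e = 2" using P_D Pe by auto
  have "\<not> e \<subseteq> f" using card_subset_eq[OF f2(2)] e2 f2 f(2) by metis
  then have "card f < card (e \<union> f)" using e2 f2 by (intro psubset_card_mono) auto
  \<comment> \<open>If \<open>e\<close> and \<open>f\<close> are disjoint,
    \<open>e \<union> f\<close> has 4 elements and is no triple; including it in the union below is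
    harmless.\<close>
  then have ef: "3 \<le> card (e \<union> f)" using f2 by simp
  have "{T \<in> [U]\<^bsup>3\<^esup>. f \<subseteq> T} \<subseteq> {e \<union> f} \<union> (\<Union>A\<in>?F. {T \<in> [A]\<^bsup>3\<^esup>. f \<subseteq> T})"
  proof
    fix T assume "T \<in> {T \<in> [U]\<^bsup>3\<^esup>. f \<subseteq> T}"
    then have T: "T \<in> [U]\<^bsup>3\<^esup>" "f \<subseteq> T" and T3: "finite T" "card T = 3" by (auto simp: nsets_def)
    show "T \<in> {e \<union> f} \<union> (\<Union>A\<in>?F. {T \<in> [A]\<^bsup>3\<^esup>. f \<subseteq> T})"
    proof (cases "e \<subseteq> T")
      case True
      then have "e \<union> f = T" using T T3 ef by (intro card_seteq) auto
      then show ?thesis by simp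
    next
      case False
      then obtain A where "A \<in> Q" "T \<subseteq> A" using covers[OF T(1)] Pe by blast
      moreover from this have "A \<in> ?F" using T by blast
      moreover have "T \<in> [A]\<^bsup>3\<^esup>" using calculation T3 by (simp add: nsets_def)
      ultimately show ?thesis using T(2) by blast
    qed
  qed
  then have "card {T \<in> [U]\<^bsup>3\<^esup>. f \<subseteq> T} \<le> card ({e \<union> f} \<union> (\<Union>A\<in>?F. {T \<in> [A]\<^bsup>3\<^esup>. f \<subseteq> T}))"
    using finite_Q Q_D by (intro card_mono) (auto simp: finite_imp_finite_nsets)
  also have "\<dots> \<le> card {e \<union> f} + card (\<Union>A\<in>?F. {T \<in> [A]\<^bsup>3\<^esup>. f \<subseteq> T})"
    by (rule card_Un_le)
  also have "card (\<Union>A\<in>?F. {T \<in> [A]\<^bsup>3\<^esup>. f \<subseteq> T}) \<le> (\<Sum>A\<in>?F. card {T \<in> [A]\<^bsup>3\<^esup>. f \<subseteq> T})"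
    using finite_Q by (intro card_UN_le) simp
  also have "\<dots> = (\<Sum>A\<in>?F. 2)"
    by (rule sum.cong) (use Q_D f2 in \<open>auto simp: card_supersets\<close>)
  finally have "card {T \<in> [U]\<^bsup>3\<^esup>. f \<subseteq> T} \<le> 1 + 2 * card ?F" by simp
  moreover have "card {T \<in> [U]\<^bsup>3\<^esup>. f \<subseteq> T} = 4"
    using f2 finite_U U by (simp add: card_supersets)
  ultimately show ?thesis by simp
qed

lemma lower_bound_six:
  assumes U: "card U = 6"
  shows "6 \<le> card P + card Q"
proof (rule ccontr)
  assume less: "\<not> ?thesis"
  have c: "(6 :: nat) choose 3 = 20" "(5 :: nat) choose 3 = 10" by (simp_all add: eval_nat_numeral)
  have U3: "3 \<le> card U" using U by simp
  \<comment> \<open>For 6 points both coefficients in Goodman's bound are 12, so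
    \<open>60 \<le> 12 * (card P + card Q)\<close>.\<close>
  have pq: "card P + card Q = 5" using goodman less by (simp add: U c)
  have "pdeg v + qdeg v \<le> (5 + card Q) div 3" if "v \<in> U" for v
    using delete_vertex[OF that U3] pq c by (simp add: U)
  then have "(\<Sum>v\<in>U. pdeg v + qdeg v) \<le> (\<Sum>v\<in>U. (5 + card Q) div 3)"
    by (rule sum_mono)
  then have "2 * card P + 4 * card Q \<le> 6 * ((5 + card Q) div 3)"
    by (simp add: sum.distrib sum_pdeg sum_qdeg U)
  moreover have "card Q = 0 \<or> card Q = 1 \<or> card Q = 2 \<or> card Q = 3 \<or> card Q = 4 \<or> card Q = 5"
    using pq by linarith
  \<comment> \<open>The summed bound reads
    \<open>10 + 2 * card Q \<le> 6 * ((5 + card Q) div 3)\<close>. Rounding leaves only 1 and 4,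
    where it is an equality.\<close>
  ultimately have "card Q = 1 \<and> card P = 4 \<or> card Q = 4 \<and> card P = 1"
    by (elim disjE) (use pq in simp_all)
  moreover have "\<not> (card Q = 1 \<and> card P = 4)"
    using goodman_linear[of 1] by (auto simp: U c)
  ultimately have Q4: "card Q = 4" and "card P = 1" by auto
  then obtain e where e: "P = {e}" by (auto simp: card_1_singleton_iff)
  \<comment> \<open>Each of the 14 pairs other than \<open>e\<close> lies in two or more members of
    \<open>Q\<close>, but four 4-sets contain only 24 pairs with multiplicity.\<close>
  let ?D = "[U]\<^bsup>2\<^esup> - {e}"
  have fin: "finite ([U]\<^bsup>2\<^esup>)" by (simp add: finite_U finite_imp_finite_nsets)
  have "card ?D = 14"
    using P e U fin by (simp add: choose_two)
  then have "28 = (\<Sum>f\<in>?D. 2 :: nat)" by simp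
  also have "\<dots> \<le> (\<Sum>f\<in>?D. card {A \<in> Q. f \<subseteq> A})"
    by (rule sum_mono) (use quads_over_pair[OF U e] in blast)
  also have "\<dots> \<le> (\<Sum>f\<in>[U]\<^bsup>2\<^esup>. card {A \<in> Q. f \<subseteq> A})"
    by (rule sum_mono2[OF fin]) auto
  also have "\<dots> = (\<Sum>A\<in>Q. card {f \<in> [U]\<^bsup>2\<^esup>. f \<subseteq> A})"
    by (rule sum_card_incidence[OF fin finite_Q])
  also have "\<dots> = (\<Sum>A\<in>Q. 6)"
  proof (rule sum.cong[OF refl])
    fix A assume A: "A \<in> Q"
    have "{f \<in> [U]\<^bsup>2\<^esup>. f \<subseteq> A} = [A]\<^bsup>2\<^esup>" using Q_D[OF A] by (auto simp: nsets_def)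
    then show "card {f \<in> [U]\<^bsup>2\<^esup>. f \<subseteq> A} = 6" using Q_D[OF A] by (simp add: choose_two)
  qed
  finally show False using Q4 by simp
qed

lemma lower_bound:
  assumes "6 \<le> card U"
  shows "(card U - 1)\<^sup>2 div 4 \<le> card P + card Q"
proof -
  have "card U = 6 \<or> card U = 7 \<or> (8 \<le> card U \<and> card U \<le> 12) \<or> 13 \<le> card U"
    using assms by linarith
  then show ?thesis
    using lower_bound_six lower_bound_seven lower_bound_medium lower_bound_large by auto
qed

end

section \<open>Cliques of the Johnson graph\<close>

text \<open>Take distinct members \<open>S\<close> and \<open>T\<close>. Either all members contain
  \<open>S \<inter> T\<close>, or some \<open>R\<close> does not, and then the clique is confined to
  the 4-set \<open>S \<union> T\<close>.\<close>

lemma clique_pair_or_quad: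
  assumes U: "finite U" "4 \<le> card U" and C: "C \<subseteq> [U]\<^bsup>3\<^esup>"
    and adj: "\<And>S T. S \<in> C \<Longrightarrow> T \<in> C \<Longrightarrow> S \<noteq> T \<Longrightarrow> card (S \<inter> T) = 2"
  shows "(\<exists>e\<in>[U]\<^bsup>2\<^esup>. \<forall>T\<in>C. e \<subseteq> T) \<or> (\<exists>A\<in>[U]\<^bsup>4\<^esup>. \<forall>T\<in>C. T \<subseteq> A)"
proof -
  have C_D: "S \<subseteq> U \<and> finite S \<and> card S = 3" if "S \<in> C" for S
    using that C by (auto simp: nsets_def)
  consider "C = {}" | S where "C = {S}" | S T where "S \<in> C" "T \<in> C" "S \<noteq> T"
    by (metis is_singletonI' is_singleton_def)
  then show ?thesis
  proof cases
    case 1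
    obtain e where "e \<subseteq> U" "card e = 2" "finite e"
      using obtain_subset_with_card_n[of 2 U] U by auto
    then show ?thesis using 1 by (auto simp: nsets_def)
  next
    case (2 S)
    then have "S \<subseteq> U" "card S = 3" using C_D by auto
    moreover obtain e where "e \<subseteq> S" "card e = 2" "finite e"
      using obtain_subset_with_card_n[of 2 S] calculation by auto
    ultimately show ?thesis using 2 by (auto simp: nsets_def)
  next
    case (3 S T)
    \<comment> \<open>\<open>R\<close> differs from \<open>S\<close> and \<open>T\<close> and meets
      each in 2 points, but has at most 1 point in \<open>S \<inter> T\<close>. So it has at least 2
      + 2 - 1 = 3 points in \<open>S \<union> T\<close>.\<close>
    have in_union: "R \<subseteq> S \<union> T"
      if "S \<in> C" "T \<in> C" "R \<in> C" "S \<noteq> T" "\<not> S \<inter> T \<subseteq> R" for R S T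
    proof -
      have RST: "card (R \<inter> S) = 2" "card (R \<inter> T) = 2" "card (S \<inter> T) = 2"
        using that by (auto intro!: adj)
      have "card (R \<inter> (S \<inter> T)) < card (S \<inter> T)"
        using that C_D by (intro psubset_card_mono) auto
      moreover have "card (R \<inter> S) + card (R \<inter> T) = card (R \<inter> (S \<union> T)) + card (R \<inter> (S \<inter> T))"
      proof -
        have "R \<inter> (S \<union> T) = (R \<inter> S) \<union> (R \<inter> T)" "R \<inter> (S \<inter> T) = (R \<inter> S) \<inter> (R \<inter> T)" by auto
        then show ?thesis using that C_D by (simp only:) (intro card_Un_Int, auto)
      qed
      ultimately have "card R \<le> card (R \<inter> (S \<union> T))"
        using RST C_D that by simp
      then have "R \<inter> (S \<union> T) = R"
        using that C_D by (intro card_seteq) auto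
      then show ?thesis by blast
    qed
    show ?thesis
    proof (cases "\<forall>R\<in>C. S \<inter> T \<subseteq> R")
      case True
      moreover have "S \<inter> T \<in> [U]\<^bsup>2\<^esup>" using 3 C_D adj by (auto simp: nsets_def)
      ultimately show ?thesis by blast
    next
      case False
      then obtain R where R: "R \<in> C" "\<not> S \<inter> T \<subseteq> R" by blast
      then have RS: "R \<noteq> S" by auto
      have R_sub: "R \<subseteq> S \<union> T" by (rule in_union) (use 3 R in auto)
      have "X \<subseteq> S \<union> T" if X: "X \<in> C" for X
      proof (cases "S \<inter> T \<subseteq> X")
        case False
        then show ?thesis using in_union[of S T X] 3 X by blast
      next
        case ST: True
        show ?thesis
        proof (cases "S \<inter> R \<subseteq> X")
          case False
          then have "X \<subseteq> S \<union> R" using in_union[of S R X] 3 X R RS by blast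
          then show ?thesis using R_sub by blast
        next
          case SR: True
          \<comment> \<open>\<open>S \<inter> T\<close> and \<open>S \<inter> R\<close> are
            different pairs in \<open>S\<close>. A member \<open>X\<close> containing both shares at
            least 3 points with \<open>S\<close>, so it equals \<open>S\<close>.\<close>
          have "S \<inter> T \<subset> (S \<inter> T) \<union> (S \<inter> R)"
          proof -
            have "card (S \<inter> T) = 2" "card (S \<inter> R) = 2" using 3 R RS adj by auto
            then have "\<not> S \<inter> R \<subseteq> S \<inter> T"
              using R card_subset_eq[of "S \<inter> T" "S \<inter> R"] C_D 3 by auto
            then show ?thesis by blast
          qed
          then have "card (S \<inter> T) < card ((S \<inter> T) \<union> (S \<inter> R))"
            using C_D 3 by (intro psubset_card_mono) auto
          also have "\<dots> \<le> card (S \<inter> X)"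
            using ST SR C_D 3 by (intro card_mono) auto
          finally have "card (S \<inter> X) \<noteq> 2" using 3 adj by simp
          then have "X = S" using adj 3 X by blast
          then show ?thesis by blast
        qed
      qed
      moreover have "card (S \<union> T) = 4"
        using card_Un_Int[of S T] adj[OF 3] C_D[OF 3(1)] C_D[OF 3(2)] by simp
      then have "S \<union> T \<in> [U]\<^bsup>4\<^esup>" using 3 C_D by (auto simp: nsets_def)
      ultimately show ?thesis by blast
    qed
  qed
qed

section \<open>Translation between clique covers and covers by pairs and 4-sets\<close>

lemma johnson_edge_iff:
  assumes "S \<in> [{1..N}]\<^bsup>k\<^esup>" "T \<in> [{1..N}]\<^bsup>k\<^esup>"
  shows "{S, T} \<in> snd (johnson_graph N k) \<longleftrightarrow> card (S \<inter> T) = k - 1"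
proof
  assume "{S, T} \<in> snd (johnson_graph N k)"
  then obtain S' T' where "{S, T} = {S', T'}" "card (S' \<inter> T') = k - 1"
    unfolding johnson_graph_def by auto
  then show "card (S \<inter> T) = k - 1"
    by (metis Int_commute doubleton_eq_iff)
next
  assume "card (S \<inter> T) = k - 1"
  with assms show "{S, T} \<in> snd (johnson_graph N k)"
    unfolding johnson_graph_def snd_conv mem_Collect_eq by (intro exI[of _ S] exI[of _ T] conjI refl)
qed

lemma pair_quad_cover_of_clique_cover:
  assumes N: "4 \<le> N" and fin: "finite \<C>" and cov: "clique_cover (johnson_graph N 3) \<C>"
  obtains P Q where "pair_quad_cover {1..N} P Q" "card P + card Q \<le> card \<C>"
proof -
  let ?U = "{1..N}"
  \<comment> \<open>A clique of both types is assigned to the pairs, so each clique yields exactly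
    one set. Different cliques may yield the same set, which only lowers the count.\<close>
  define CP where "CP = {C \<in> \<C>. \<exists>e\<in>[?U]\<^bsup>2\<^esup>. \<forall>T\<in>C. e \<subseteq> T}"
  have sub: "C \<subseteq> [?U]\<^bsup>3\<^esup>" if "C \<in> \<C>" for C
    using cov that by (auto simp: clique_cover_def johnson_graph_def)
  have "\<forall>C\<in>CP. \<exists>e. e \<in> [?U]\<^bsup>2\<^esup> \<and> (\<forall>T\<in>C. e \<subseteq> T)" by (auto simp: CP_def)
  from bchoice[OF this] obtain f where f: "\<forall>C\<in>CP. f C \<in> [?U]\<^bsup>2\<^esup> \<and> (\<forall>T\<in>C. f C \<subseteq> T)"
    by (elim exE)
  have "\<forall>C\<in>\<C> - CP. \<exists>A. A \<in> [?U]\<^bsup>4\<^esup> \<and> (\<forall>T\<in>C. T \<subseteq> A)"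
  proof
    fix C assume C: "C \<in> \<C> - CP"
    have "card (S \<inter> T) = 2" if "S \<in> C" "T \<in> C" "S \<noteq> T" for S T
    proof -
      have "{S, T} \<in> snd (johnson_graph N 3)"
        using cov C that unfolding clique_cover_def clique_def by blast
      then show ?thesis using johnson_edge_iff[of S N 3 T] sub C that by auto
    qed
    then have "(\<exists>e\<in>[?U]\<^bsup>2\<^esup>. \<forall>T\<in>C. e \<subseteq> T) \<or> (\<exists>A\<in>[?U]\<^bsup>4\<^esup>. \<forall>T\<in>C. T \<subseteq> A)"
      using N sub C by (intro clique_pair_or_quad) simp_all
    then show "\<exists>A. A \<in> [?U]\<^bsup>4\<^esup> \<and> (\<forall>T\<in>C. T \<subseteq> A)"
      using C unfolding CP_def by blast
  qed
  from bchoice[OF this] obtain g where g: "\<forall>C\<in>\<C> - CP. g C \<in> [?U]\<^bsup>4\<^esup> \<and> (\<forall>T\<in>C. T \<subseteq> g C)"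
    by (elim exE)
  show thesis
  proof
    show "pair_quad_cover ?U (f ` CP) (g ` (\<C> - CP))"
    proof
      fix T assume "T \<in> [?U]\<^bsup>3\<^esup>"
      then have "T \<in> \<Union>\<C>"
        using cov by (simp add: clique_cover_def johnson_graph_def)
      then obtain C where C: "C \<in> \<C>" "T \<in> C" by blast
      show "(\<exists>e\<in>f ` CP. e \<subseteq> T) \<or> (\<exists>A\<in>g ` (\<C> - CP). T \<subseteq> A)"
      proof (cases "C \<in> CP")
        case True
        then have "f C \<subseteq> T" "f C \<in> f ` CP" using f C(2) by simp_all
        then show ?thesis by (intro disjI1 bexI[of _ "f C"])
      next
        case False
        then have "T \<subseteq> g C" "g C \<in> g ` (\<C> - CP)" using g C by simp_all
        then show ?thesis by (intro disjI2 bexI[of _ "g C"])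
      qed
    qed (use f g in \<open>simp_all add: image_subset_iff\<close>)
    have "card (f ` CP) + card (g ` (\<C> - CP)) \<le> card CP + card (\<C> - CP)"
      using fin by (intro add_mono card_image_le) (auto simp: CP_def)
    also have "\<dots> = card \<C>"
      using fin by (simp add: CP_def card_Diff_subset card_mono)
    finally show "card (f ` CP) + card (g ` (\<C> - CP)) \<le> card \<C>" .
  qed
qed

text \<open>Distinct triples share at most 2 points. They share at least 2 if both contain a common
  pair, or if both lie in a 4-set, since 3 + 3 - 4 = 2.\<close>

lemma clique_cover_of_pair_quad_cover:
  assumes "pair_quad_cover {1..N} P Q"
  shows "clique_cover (johnson_graph N 3)
    ((\<lambda>e. {T \<in> [{1..N}]\<^bsup>3\<^esup>. e \<subseteq> T}) ` P \<union> (\<lambda>A. {T \<in> [{1..N}]\<^bsup>3\<^esup>. T \<subseteq> A}) ` Q)"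
proof -
  interpret pair_quad_cover "{1..N}" P Q by fact
  let ?V = "[{1..N}]\<^bsup>3\<^esup>"
  have lt: "card (S \<inter> T) < 3" if "S \<in> ?V" "T \<in> ?V" "S \<noteq> T" for S T
  proof -
    have "S \<inter> T \<noteq> S"
      using that card_subset_eq[of T S] by (auto simp: nsets_def)
    then have "card (S \<inter> T) < card S"
      using that by (intro psubset_card_mono) (auto simp: nsets_def)
    then show ?thesis using that by (simp add: nsets_def)
  qed
  have "clique {T \<in> ?V. e \<subseteq> T} (snd (johnson_graph N 3))" if e: "e \<in> P" for e
  proof -
    have "card (S \<inter> T) = 2" if "S \<in> ?V" "T \<in> ?V" "S \<noteq> T" "e \<subseteq> S" "e \<subseteq> T" for S T
    proof -
      have "card e \<le> card (S \<inter> T)" using that by (intro card_mono) (auto simp: nsets_def)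
      then show ?thesis using lt[OF that(1,2,3)] P_D[OF e] by simp
    qed
    then show ?thesis by (auto simp: clique_def johnson_edge_iff)
  qed
  moreover have "clique {T \<in> ?V. T \<subseteq> A} (snd (johnson_graph N 3))" if A: "A \<in> Q" for A
  proof -
    have "card (S \<inter> T) = 2" if "S \<in> ?V" "T \<in> ?V" "S \<noteq> T" "S \<subseteq> A" "T \<subseteq> A" for S T
    proof -
      have "card (S \<union> T) \<le> card A" using that Q_D[OF A] by (intro card_mono) auto
      moreover have "card S + card T = card (S \<union> T) + card (S \<inter> T)"
        using that by (intro card_Un_Int) (auto simp: nsets_def)
      ultimately show ?thesis using lt[OF that(1,2,3)] Q_D[OF A] that by (simp add: nsets_def)
    qed
    then show ?thesis by (auto simp: clique_def johnson_edge_iff)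
  qed
  moreover have "(\<Union>e\<in>P. {T \<in> ?V. e \<subseteq> T}) \<union> (\<Union>A\<in>Q. {T \<in> ?V. T \<subseteq> A}) = ?V"
  proof
    show "?V \<subseteq> (\<Union>e\<in>P. {T \<in> ?V. e \<subseteq> T}) \<union> (\<Union>A\<in>Q. {T \<in> ?V. T \<subseteq> A})"
      using covers by fast
  qed auto
  moreover have "fst (johnson_graph N 3) = ?V" by (simp add: johnson_graph_def)
  ultimately show ?thesis
    unfolding clique_cover_def Union_Un_distrib by (simp add: ball_Un)
qed

lemma theta_johnson_le:
  assumes "pair_quad_cover {1..N} P Q"
  shows "\<theta> (johnson_graph N 3) \<le> card P + card Q"
proof -
  interpret pair_quad_cover "{1..N}" P Q by fact
  define \<C> where
    "\<C> = (\<lambda>e. {T \<in> [{1..N}]\<^bsup>3\<^esup>. e \<subseteq> T}) ` P \<union> (\<lambda>A. {T \<in> [{1..N}]\<^bsup>3\<^esup>. T \<subseteq> A}) ` Q"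
  have "finite \<C>" "clique_cover (johnson_graph N 3) \<C>"
    using finite_P finite_Q clique_cover_of_pair_quad_cover[OF assms] by (auto simp: \<C>_def)
  then have "\<theta> (johnson_graph N 3) \<le> card \<C>"
    unfolding clique_cover_number_def by (intro Least_le) blast
  also have "\<dots> \<le> card P + card Q"
    unfolding \<C>_def using finite_P finite_Q
    by (intro order_trans[OF card_Un_le] add_mono card_image_le)
  finally show ?thesis .
qed

lemma theta_johnson_ge:
  assumes "4 \<le> N" and "\<And>P Q. pair_quad_cover {1..N} P Q \<Longrightarrow> m \<le> card P + card Q"
  shows "m \<le> \<theta> (johnson_graph N 3)"
proof -
  have "finite (fst (johnson_graph N 3))"
    by (simp add: johnson_graph_def finite_imp_finite_nsets)
  from ex_finite_clique_cover[OF this]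
  have "\<exists>n \<C>. finite \<C> \<and> clique_cover (johnson_graph N 3) \<C> \<and> card \<C> = n" by blast
  then have "\<exists>\<C>. finite \<C> \<and> clique_cover (johnson_graph N 3) \<C> \<and> card \<C> = \<theta> (johnson_graph N 3)"
    unfolding clique_cover_number_def by (rule LeastI_ex)
  then obtain \<C> where \<C>: "finite \<C>" "clique_cover (johnson_graph N 3) \<C>"
    "card \<C> = \<theta> (johnson_graph N 3)" by blast
  obtain P Q where "pair_quad_cover {1..N} P Q" "card P + card Q \<le> card \<C>"
    using pair_quad_cover_of_clique_cover[OF assms(1) \<C>(1,2)] .
  with assms(2) \<C>(3) show ?thesis by fastforce
qed

lemma pair_quad_cover_halves:
  assumes U: "finite U" "A \<union> B = U" "A \<inter> B = {}"
  shows "pair_quad_cover U ([A]\<^bsup>2\<^esup> \<union> [B]\<^bsup>2\<^esup>) {}"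
proof
  fix T assume T: "T \<in> [U]\<^bsup>3\<^esup>"
  then have "card (T \<inter> A) + card (T \<inter> B) = card ((T \<inter> A) \<union> (T \<inter> B))"
    using U by (intro card_Un_disjoint[symmetric]) (auto simp: nsets_def)
  also have "(T \<inter> A) \<union> (T \<inter> B) = T" using T U by (auto simp: nsets_def)
  finally have "card (T \<inter> A) + card (T \<inter> B) = 3" using T by (simp add: nsets_def)
  \<comment> \<open>Pigeonhole: one part receives two of the three points.\<close>
  then have "2 \<le> card (T \<inter> A) \<or> 2 \<le> card (T \<inter> B)" by linarith
  then obtain e where "e \<subseteq> T \<inter> A \<or> e \<subseteq> T \<inter> B" "card e = 2" "finite e"
    by (meson obtain_subset_with_card_n)
  then show "(\<exists>e\<in>[A]\<^bsup>2\<^esup> \<union> [B]\<^bsup>2\<^esup>. e \<subseteq> T) \<or> (\<exists>A\<in>{}. T \<subseteq> A)"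
    by (auto simp: nsets_def)
next
  show "[A]\<^bsup>2\<^esup> \<union> [B]\<^bsup>2\<^esup> \<subseteq> [U]\<^bsup>2\<^esup>" using U(2) by (intro Un_least nsets_mono) auto
qed (use U(1) in simp_all)

lemma choose_two_halves:
  "((n div 2) choose 2) + ((n - n div 2) choose 2) = (n - 1)\<^sup>2 div 4" for n :: nat
proof (cases "even n")
  case True
  then obtain m where n: "n = 2 * m" by blast
  show ?thesis
  \<comment> \<open>For \<open>m = 0\<close> the truncated \<open>n - 1\<close> is 0, so the
    expansion of the square below needs \<open>m = Suc j\<close>.\<close>
  proof (cases m)
    case (Suc j)
    have "(n - 1)\<^sup>2 = 4 * (j * (j + 1)) + 1"
      by (simp add: n Suc power2_eq_square algebra_simps)
    moreover have "2 * (m choose 2) = j * (j + 1)"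
      using two_choose_two[of m] by (simp add: Suc)
    ultimately show ?thesis by (simp add: n)
  qed (simp add: n)
next
  case False
  then obtain m where n: "n = 2 * m + 1" using oddE by blast
  have "2 * (m choose 2) + m = m * m"
    unfolding two_choose_two by (cases m) simp_all
  moreover have "Suc m choose 2 = (m choose 2) + m" by (simp add: eval_nat_numeral)
  moreover have "(n - 1)\<^sup>2 = 4 * (m * m)" by (simp add: n power2_eq_square)
  ultimately show ?thesis by (simp add: n)
qed

theorem theorem2p7:
  fixes N :: nat
  assumes "N > 3"
  shows "\<theta> (johnson_graph N 3) =
           (if N = 4 then 1 else if N = 5 then 3 else (N - 1)\<^sup>2 div 4)"
proof -
  consider "N = 4" | "N = 5" | "N \<ge> 6" using assms by linarith
  then show ?thesis
  proof cases
    case 1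
    have "pair_quad_cover {1..4 :: nat} {} {{1..4}}"
      by unfold_locales (auto simp: nsets_def)
    from theta_johnson_le[OF this] have "\<theta> (johnson_graph 4 3) \<le> 1" by simp
    moreover have "1 \<le> \<theta> (johnson_graph 4 3)"
    proof (rule theta_johnson_ge)
      fix P Q assume "pair_quad_cover {1..4 :: nat} P Q"
      then interpret pair_quad_cover "{1..4 :: nat}" P Q .
      \<comment> \<open>The bound reads \<open>12 + ... \<le> 6 * card P + 12 * card Q\<close>, so
        \<open>P\<close> and \<open>Q\<close> are not both empty.\<close>
      show "1 \<le> card P + card Q" using goodman by (simp add: eval_nat_numeral)
    qed simp
    ultimately show ?thesis using 1 by simp
  next
    case 2
    \<comment> \<open>A triple either contains both 4 and 5, or omits one of them and lies in the
      complement of that point.\<close>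
    have "pair_quad_cover {1..5 :: nat} {{4, 5}} {{1, 2, 3, 4}, {1, 2, 3, 5}}"
    proof
      fix T :: "nat set" assume T: "T \<in> [{1..5}]\<^bsup>3\<^esup>"
      have "{1..5 :: nat} = {1, 2, 3, 4, 5}" by auto
      then have "T \<subseteq> {1, 2, 3, 4, 5}" using T by (simp add: nsets_def)
      then show "(\<exists>e\<in>{{4, 5}}. e \<subseteq> T) \<or> (\<exists>A\<in>{{1, 2, 3, 4}, {1, 2, 3, 5}}. T \<subseteq> A)"
        by (cases "4 \<in> T"; cases "5 \<in> T") auto
    qed (auto simp: nsets_def)
    from theta_johnson_le[OF this]
    have "\<theta> (johnson_graph 5 3) \<le> 3" by (simp add: card_insert_if doubleton_eq_iff split: if_splits)
    moreover have "3 \<le> \<theta> (johnson_graph 5 3)"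
      by (rule theta_johnson_ge) (auto intro: pair_quad_cover.lower_bound_five)
    ultimately show ?thesis using 2 by simp
  next
    case 3
    \<comment> \<open>The two parts are as equal as possible, with sizes \<open>N div 2\<close> and
      \<open>N - N div 2\<close>, as in \<open>choose_two_halves\<close>.\<close>
    let ?A = "{1..N div 2}" and ?B = "{N div 2 + 1..N}"
    have "pair_quad_cover {1..N} ([?A]\<^bsup>2\<^esup> \<union> [?B]\<^bsup>2\<^esup>) {}"
      by (rule pair_quad_cover_halves) auto
    from theta_johnson_le[OF this]
    have "\<theta> (johnson_graph N 3) \<le> card ([?A]\<^bsup>2\<^esup> \<union> [?B]\<^bsup>2\<^esup>)" by simp
    also have "\<dots> \<le> card ([?A]\<^bsup>2\<^esup>) + card ([?B]\<^bsup>2\<^esup>)" by (rule card_Un_le)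
    also have "\<dots> = (N - 1)\<^sup>2 div 4" by (simp add: choose_two_halves)
    finally have "\<theta> (johnson_graph N 3) \<le> (N - 1)\<^sup>2 div 4" .
    moreover have "(N - 1)\<^sup>2 div 4 \<le> \<theta> (johnson_graph N 3)"
      using 3 pair_quad_cover.lower_bound[of "{1..N}"] by (intro theta_johnson_ge) auto
    ultimately show ?thesis using 3 by simp
  qed
qed

end
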